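(* Let $\mu>-\frac12$, $\beta>-\frac{d+1}2$, let $0\le m\le n$ be integers and $\mathbf k\in\mathbb N_0^d$ with $|\mathbf k|=m$. Let $\mathbf C_{m,\mathbf k}^n$ (depending on $\gamma>-\frac12$) be the generalized Gegenbauer polynomials on the solid double cone and $\mathbf H_{m,\mathbf k}^n$ the generalized Hermite polynomials on the solid double cone, with squared norms $h_{m,n}^{\mathbf C}$ and $h_{m,n}^{\mathbf H}$. Then $$\lim_{\gamma\to\infty}\frac{\mathbf C_{m,\mathbf k}^n\big(\frac x{\sqrt\gamma},\frac t{\sqrt\gamma}\big)}{\sqrt{h_{m,n}^{\mathbf C}}}=\frac{\mathbf H_{m,\mathbf k}^n(x,t)}{\sqrt{h_{m,n}^{\mathbf H}}}.$$
   Context: Let $\{P_{\mathbf k}^m:|\mathbf k|=m,\ \mathbf k\in\mathbb N_0^d\}$ be an orthonormal basis of the space of orthogonal polynomials of degree $m$ on the unit ball $\mathbb B^d$ with respect to $(1-\|x\|^2)^{\mu-\frac12}$, normalized to a probability measure. Generalized Gegenbauer polynomials: $C_{2k}^{(\lambda,a)}(t)=\frac{(\lambda+a)_k}{(a+\frac12)_k}P_k^{(\lambda-\frac12,a-\frac12)}(2t^2-1)$ and $C_{2k+1}^{(\lambda,a)}(t)=\frac{(\lambda+a)_{k+1}}{(a+\frac12)_{k+1}}\,t\,P_k^{(\lambda-\frac12,a+\frac12)}(2t^2-1)$, with $P_k^{(\cdot,\cdot)}$ the Jacobi polynomials and $(a)_k$ the Pochhammer symbol. Generalized Hermite polynomials: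 $H_{2k}^a(t)=(-1)^k2^{2k}k!\,L_k^{a-\frac12}(t^2)$ and $H_{2k+1}^a(t)=(-1)^k2^{2k+1}k!\,t\,L_k^{a+\frac12}(t^2)$, with $L_k^{b}$ the Laguerre polynomials. With $a=m+\beta+\mu+\frac{d-1}2$, set $$\mathbf C_{m,\mathbf k}^n(x,t)=C_{n-m}^{(\gamma,a)}(t)\,t^mP_{\mathbf k}^m(x/t),\qquad\mathbf H_{m,\mathbf k}^n(x,t)=H_{n-m}^{a}(t)\,t^mP_{\mathbf k}^m(x/t),\qquad x\in\mathbb R^d,\ t\in\mathbb R,$$ which are polynomials in $(x,t)$. The squared norms are $h_{m,n}^{\mathbf C}=b\int|\mathbf C_{m,\mathbf k}^n|^2|t|^{2\beta}(1-t^2)^{\gamma-\frac12}(t^2-\|x\|^2)^{\mu-\frac12}dx\,dt$ over $\{\|x\|\le|t|\le1\}$ and $h_{m,n}^{\mathbf H}=b'\int|\mathbf H_{m,\mathbf k}^n|^2|t|^{2\beta}e^{-t^2}(t^2-\|x\|^2)^{\mu-\frac12}dx\,dt$ over $\{\|x\|\le|t|\}$. The constants $b,b'$ are such that the constant $1$ has norm $1$. *)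

theory Defs
  imports "HOL-Analysis.Analysis" "HOL-Library.Poly_Mapping"
begin

text \<open>
  Real polynomials in d variables, with d the cardinality of the index type, as finitely
  supported coefficient families: the monomial with exponent vector \<open>\<alpha>\<close> is the product of the
  \<open>x $ i ^ \<alpha> i\<close>.  The multi-indices that label an orthonormal basis have the same type as the
  exponent vectors.
\<close>

type_synonym 'd mpoly = "('d \<Rightarrow> nat) \<Rightarrow>\<^sub>0 real"

definition mdeg :: "('d::finite \<Rightarrow> nat) \<Rightarrow> nat" where
  "mdeg \<alpha> = (\<Sum>i\<in>UNIV. \<alpha> i)"

definition meval :: "'d::finite mpoly \<Rightarrow> real ^ 'd \<Rightarrow> real" where
  "meval p x = (\<Sum>\<alpha>\<in>Poly_Mapping.keys p. Poly_Mapping.lookup p \<alpha> * (\<Prod>i\<in>UNIV. (x $ i) ^ \<alpha> i))"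

text \<open>
  The polynomial in \<open>(x, t)\<close> that is written \<open>t\<^sup>m p(x/t)\<close>.  It is given by its coefficients so
  that its value at \<open>t = 0\<close> is the right one; it is only meaningful for \<open>p\<close> of degree at
  most \<open>m\<close> (see \<open>homogenize_eq\<close>).
\<close>

definition homogenize :: "nat \<Rightarrow> 'd::finite mpoly \<Rightarrow> real ^ 'd \<Rightarrow> real \<Rightarrow> real" where
  "homogenize m p x t =
     (\<Sum>\<alpha>\<in>Poly_Mapping.keys p.
        Poly_Mapping.lookup p \<alpha> * (\<Prod>i\<in>UNIV. (x $ i) ^ \<alpha> i) * t ^ (m - mdeg \<alpha>))"

lemma homogenize_eq:
  fixes x :: "real ^ 'd::finite"
  assumes "\<forall>\<alpha>\<in>Poly_Mapping.keys p. mdeg \<alpha> \<le> m" "t \<noteq> 0"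
  shows "homogenize m p x t = t ^ m * meval p (x /\<^sub>R t)"
proof -
  have "t ^ m * (\<Prod>i\<in>UNIV. ((x /\<^sub>R t) $ i) ^ \<alpha> i) = (\<Prod>i\<in>UNIV. (x $ i) ^ \<alpha> i) * t ^ (m - mdeg \<alpha>)"
    if "\<alpha> \<in> Poly_Mapping.keys p" for \<alpha>
  proof -
    have "((x /\<^sub>R t) $ i) ^ \<alpha> i = (x $ i) ^ \<alpha> i / t ^ \<alpha> i" for i
      by (simp add: field_simps power_divide)
    then have "(\<Prod>i\<in>UNIV. ((x /\<^sub>R t) $ i) ^ \<alpha> i) = (\<Prod>i\<in>UNIV. (x $ i) ^ \<alpha> i) / t ^ mdeg \<alpha>"
      by (simp only: prod_dividef mdeg_def power_sum)
    moreover have "t ^ (m - mdeg \<alpha>) = t ^ m / t ^ mdeg \<alpha>"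
      using assms that by (simp add: power_diff)
    ultimately show ?thesis by simp
  qed
  then show ?thesis
    unfolding homogenize_def meval_def sum_distrib_left
    by (intro sum.cong refl) (metis (no_types, lifting) mult.assoc mult.left_commute)
qed

text \<open>
  Integral of \<open>f\<close> over \<open>S\<close> against the weight \<open>w\<close>, multiplied by the constant that gives the
  function 1 the integral 1.
\<close>

definition normalized_integral ::
    "'a::euclidean_space set \<Rightarrow> ('a \<Rightarrow> real) \<Rightarrow> ('a \<Rightarrow> real) \<Rightarrow> real" where
  "normalized_integral S w f =
     1 / (LINT z:S|lborel. w z) * (LINT z:S|lborel. f z * w z)"

definition ball_inner :: "real \<Rightarrow> 'd::finite mpoly \<Rightarrow> 'd mpoly \<Rightarrow> real" where
  "ball_inner \<mu> p q =
     normalized_integral (cball 0 1) (\<lambda>x. (1 - (norm x)\<^sup>2) powr (\<mu> - 1/2))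
       (\<lambda>x. meval p x * meval q x)"

definition ball_orthogonal_polys :: "real \<Rightarrow> nat \<Rightarrow> 'd::finite mpoly set" where
  "ball_orthogonal_polys \<mu> m =
     {p. (\<forall>\<alpha>\<in>Poly_Mapping.keys p. mdeg \<alpha> \<le> m) \<and>
         (\<forall>q. (\<forall>\<alpha>\<in>Poly_Mapping.keys q. mdeg \<alpha> < m) \<longrightarrow> ball_inner \<mu> p q = 0)}"

definition ball_orthonormal_basis ::
    "real \<Rightarrow> nat \<Rightarrow> (('d::finite \<Rightarrow> nat) \<Rightarrow> 'd mpoly) \<Rightarrow> bool" where
  "ball_orthonormal_basis \<mu> m P \<longleftrightarrow>
     (\<forall>k. mdeg k = m \<longrightarrow> P k \<in> ball_orthogonal_polys \<mu> m) \<and>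
     (\<forall>k l. mdeg k = m \<longrightarrow> mdeg l = m \<longrightarrow> ball_inner \<mu> (P k) (P l) = (if k = l then 1 else 0)) \<and>
     (\<forall>q\<in>ball_orthogonal_polys \<mu> m. \<exists>c. \<forall>\<alpha>.
        Poly_Mapping.lookup q \<alpha> = (\<Sum>k | mdeg k = m. c k * Poly_Mapping.lookup (P k) \<alpha>))"

text \<open>
  \<open>P\<^sub>n\<^bsup>(a,b)\<^esup>(x) = (a+1)\<^sub>n / n! \<cdot> 2F1(-n, n+a+b+1; a+1; (1-x)/2)\<close>, for \<open>a > -1\<close>.
\<close>

definition jacobi_poly :: "nat \<Rightarrow> real \<Rightarrow> real \<Rightarrow> real \<Rightarrow> real" where
  "jacobi_poly n a b x =
     pochhammer (a + 1) n / fact n *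
     (\<Sum>j\<le>n. pochhammer (- real n) j * pochhammer (real n + a + b + 1) j
              / (pochhammer (a + 1) j * fact j) * ((1 - x) / 2) ^ j)"

definition laguerre_poly :: "nat \<Rightarrow> real \<Rightarrow> real \<Rightarrow> real" where
  "laguerre_poly n b x = (\<Sum>j\<le>n. (-1) ^ j * ((real n + b) gchoose (n - j)) * x ^ j / fact j)"

definition gen_gegenbauer :: "nat \<Rightarrow> real \<Rightarrow> real \<Rightarrow> real \<Rightarrow> real" where
  "gen_gegenbauer n \<gamma> a t =
     (let k = n div 2 in
      if even n
      then pochhammer (\<gamma> + a) k / pochhammer (a + 1/2) k
             * jacobi_poly k (\<gamma> - 1/2) (a - 1/2) (2 * t\<^sup>2 - 1)
      else pochhammer (\<gamma> + a) (k + 1) / pochhammer (a + 1/2) (k + 1)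
             * t * jacobi_poly k (\<gamma> - 1/2) (a + 1/2) (2 * t\<^sup>2 - 1))"

definition gen_hermite :: "nat \<Rightarrow> real \<Rightarrow> real \<Rightarrow> real" where
  "gen_hermite n a t =
     (let k = n div 2 in
      if even n
      then (-1) ^ k * 2 ^ (2 * k) * fact k * laguerre_poly k (a - 1/2) (t\<^sup>2)
      else (-1) ^ k * 2 ^ (2 * k + 1) * fact k * t * laguerre_poly k (a + 1/2) (t\<^sup>2))"

text \<open>The first argument \<open>d\<close> is the dimension of \<open>x\<close>.\<close>

definition cone_param :: "nat \<Rightarrow> real \<Rightarrow> real \<Rightarrow> nat \<Rightarrow> real" where
  "cone_param d \<beta> \<mu> m = real m + \<beta> + \<mu> + (real d - 1) / 2"

text \<open>In the following, \<open>p\<close> is the member \<open>P\<^sub>k\<^sup>m\<close> of the orthonormal basis on the ball.\<close>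

definition cone_gegenbauer ::
    "real \<Rightarrow> real \<Rightarrow> real \<Rightarrow> nat \<Rightarrow> nat \<Rightarrow> 'd::finite mpoly \<Rightarrow> real ^ 'd \<Rightarrow> real \<Rightarrow> real" where
  "cone_gegenbauer \<beta> \<gamma> \<mu> m n p x t =
     gen_gegenbauer (n - m) \<gamma> (cone_param CARD('d) \<beta> \<mu> m) t * homogenize m p x t"

definition cone_hermite ::
    "real \<Rightarrow> real \<Rightarrow> nat \<Rightarrow> nat \<Rightarrow> 'd::finite mpoly \<Rightarrow> real ^ 'd \<Rightarrow> real \<Rightarrow> real" where
  "cone_hermite \<beta> \<mu> m n p x t =
     gen_hermite (n - m) (cone_param CARD('d) \<beta> \<mu> m) t * homogenize m p x t"

definition norm2_cone_gegenbauer ::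
    "real \<Rightarrow> real \<Rightarrow> real \<Rightarrow> nat \<Rightarrow> nat \<Rightarrow> 'd::finite mpoly \<Rightarrow> real" where
  "norm2_cone_gegenbauer \<beta> \<gamma> \<mu> m n p =
     normalized_integral {(x :: real ^ 'd, t :: real). norm x \<le> \<bar>t\<bar> \<and> \<bar>t\<bar> \<le> 1}
       (\<lambda>(x, t). \<bar>t\<bar> powr (2 * \<beta>) * (1 - t\<^sup>2) powr (\<gamma> - 1/2) * (t\<^sup>2 - (norm x)\<^sup>2) powr (\<mu> - 1/2))
       (\<lambda>(x, t). (cone_gegenbauer \<beta> \<gamma> \<mu> m n p x t)\<^sup>2)"

definition norm2_cone_hermite ::
    "real \<Rightarrow> real \<Rightarrow> nat \<Rightarrow> nat \<Rightarrow> 'd::finite mpoly \<Rightarrow> real" where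
  "norm2_cone_hermite \<beta> \<mu> m n p =
     normalized_integral {(x :: real ^ 'd, t :: real). norm x \<le> \<bar>t\<bar>}
       (\<lambda>(x, t). \<bar>t\<bar> powr (2 * \<beta>) * exp (- t\<^sup>2) * (t\<^sup>2 - (norm x)\<^sup>2) powr (\<mu> - 1/2))
       (\<lambda>(x, t). (cone_hermite \<beta> \<mu> m n p x t)\<^sup>2)"

end

theory Submission
  imports Defs
begin

text \<open>
  Substituting \<open>x = t y\<close> splits each norm on the cone into an integral over the ball, which
  cancels because \<open>P\<^sub>k\<^sup>m\<close> has norm 1, and an integral in \<open>t\<close> with the weight
  \<open>|t| powr (2 a)\<close> (for the function) or \<open>|t| powr (2 a - 2 m)\<close> (for the constant 1).  After
  \<open>t = s / sqrt \<gamma>\<close> the factor \<open>(1 - s\<^sup>2 / \<gamma>) powr (\<gamma> - 1/2)\<close> tends to \<open>exp (- s\<^sup>2)\<close>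
  and is dominated by \<open>exp (- s\<^sup>2 / 2)\<close>, while the Gegenbauer polynomial, expanded in powers of
  \<open>t\<close>, converges coefficientwise to the Hermite polynomial up to a positive factor depending
  on \<open>\<gamma>\<close> only.  This factor and the powers of \<open>\<gamma>\<close> cancel in the quotient.  The hypotheses allow
  \<open>2 a - 2 m \<le> -1\<close>, where the weights are not integrable; then both normalized norms are 0,
  since integrals of non-integrable functions and quotients by 0 are 0, and both sides vanish.
\<close>

subsection \<open>Jacobi, Laguerre and Gegenbauer polynomials\<close>

text \<open>The expansion at the other endpoint \<open>x = -1\<close>; the Chu-Vandermonde identity sums the
  coefficient of each power of \<open>u\<close>.\<close>

lemma jacobi_poly_reflect:
  assumes "\<alpha> > -1"
  shows "jacobi_poly k \<alpha> b (2 * u - 1) =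
    (\<Sum>i\<le>k. (-1) ^ k * pochhammer (- real k) i * pochhammer (real k + \<alpha> + b + 1) i
       * pochhammer (b + 1 + real i) (k - i) / (fact k * fact i) * u ^ i)"
proof -
  define A B where "A = \<alpha> + 1" and "B = real k + \<alpha> + b + 1"
  have A: "A > 0" using assms by (simp add: A_def)
  define g where "g j = pochhammer (- real k) j * pochhammer B j / (pochhammer A j * fact j)" for j
  have poch_pos: "pochhammer (A + real i) j > 0" for i j
    using A by (intro pochhammer_pos) auto
  \<comment> \<open>This is the coefficient of \<open>(- u) ^ i\<close> once every
    \<open>(1 - u) ^ j\<close> is expanded. With \<open>j = i + l\<close> it becomes a terminating
    hypergeometric sum at 1 with upper parameters \<open>B + i\<close>, \<open>- (k - i)\<close> and
    lower parameter \<open>A + i\<close>.\<close>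
  have shift: "(\<Sum>j\<le>k. g j * real (j choose i)) =
      pochhammer (- real k) i * pochhammer B i * pochhammer (A - B) (k - i)
        / (pochhammer A k * fact i)" if "i \<le> k" for i
  proof -
    have summand: "g (i + l) * real ((i + l) choose i) =
        pochhammer (- real k) i * pochhammer B i / (pochhammer A i * fact i) *
          (pochhammer (B + real i) l * pochhammer (- real (k - i)) l
             / (fact l * pochhammer (A + real i) l))" for l
    proof -
      have "- real k + real i = - real (k - i)" using that by simp
      then have 1: "pochhammer (- real k) (i + l) = pochhammer (- real k) i * pochhammer (- real (k - i)) l"
        by (metis pochhammer_product')
      have 2: "real ((i + l) choose i) = fact (i + l) / (fact i * fact l)"
        by (simp add: binomial_fact)
      have "pochhammer A i \<noteq> 0" "pochhammer (A + real i) l \<noteq> 0"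
        using poch_pos[of 0 i] poch_pos[of i l] by auto
      then show ?thesis
        unfolding g_def 1 2 pochhammer_product'[of B] pochhammer_product'[of A]
        by (simp add: field_simps)
    qed
    have "(\<Sum>j\<le>k. g j * real (j choose i)) = (\<Sum>j=i..k. g j * real (j choose i))"
      by (rule sum.mono_neutral_right) auto
    also have "\<dots> = (\<Sum>l=0..k-i. g (i + l) * real ((i + l) choose i))"
      using that by (subst sum.atLeastAtMost_shift_0) (auto simp: o_def)
    also have "\<dots> = pochhammer (- real k) i * pochhammer B i / (pochhammer A i * fact i) *
          (\<Sum>l=0..k-i. pochhammer (B + real i) l * pochhammer (- real (k - i)) l
             / (fact l * pochhammer (A + real i) l))"
      unfolding summand sum_distrib_left ..
    also have "(\<Sum>l=0..k-i. pochhammer (B + real i) l * pochhammer (- real (k - i)) l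
             / (fact l * pochhammer (A + real i) l)) =
        pochhammer (A + real i - (B + real i)) (k - i) / pochhammer (A + real i) (k - i)"
      using A by (subst Vandermonde_pochhammer[symmetric]) (auto simp: add_eq_0_iff)
    also have "A + real i - (B + real i) = A - B" by simp
    also have "pochhammer (- real k) i * pochhammer B i / (pochhammer A i * fact i) *
        (pochhammer (A - B) (k - i) / pochhammer (A + real i) (k - i)) = 
        pochhammer (- real k) i * pochhammer B i * pochhammer (A - B) (k - i)
        / (pochhammer A k * fact i)"
      using pochhammer_product[OF that, of A] by (simp add: mult_ac)
    finally show ?thesis .
  qed
  \<comment> \<open>Here \<open>A - B = - (k + b)\<close>: the parameter \<open>\<alpha>\<close>
    cancels, and reversing the product gives the sign.\<close>
  have AB: "pochhammer (A - B) (k - i) = (-1) ^ (k - i) * pochhammer (b + 1 + real i) (k - i)" if "i \<le> k" for i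
    using pochhammer_minus[of "real k + b" "k - i"] that
    by (simp add: A_def B_def of_nat_diff algebra_simps)
  \<comment> \<open>The range is extended to all \<open>i \<le> k\<close>, where the additional
    binomials vanish, so that the double sum runs over a square and can be swapped.\<close>
  have binom: "(1 - u) ^ j = (\<Sum>i\<le>k. real (j choose i) * (- u) ^ i)" if "j \<le> k" for j
  proof -
    have "(1 - u) ^ j = (\<Sum>i\<le>j. real (j choose i) * (- u) ^ i)"
      using binomial_ring[of "- u" 1 j] by simp
    also have "\<dots> = (\<Sum>i\<le>k. real (j choose i) * (- u) ^ i)"
      using that by (intro sum.mono_neutral_left) auto
    finally show ?thesis .
  qed
  have "jacobi_poly k \<alpha> b (2 * u - 1) = pochhammer A k / fact k * (\<Sum>j\<le>k. g j * (1 - u) ^ j)"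
  proof -
    have J: "jacobi_poly k \<alpha> b x = pochhammer A k / fact k * (\<Sum>j\<le>k. g j * ((1 - x) / 2) ^ j)" for x
      by (simp add: jacobi_poly_def A_def B_def g_def)
    have "(1 - (2 * u - 1)) / 2 = 1 - u" by (simp add: field_simps)
    then show ?thesis unfolding J by presburger
  qed
  also have "(\<Sum>j\<le>k. g j * (1 - u) ^ j) = (\<Sum>j\<le>k. \<Sum>i\<le>k. g j * (real (j choose i) * (- u) ^ i))"
    using binom by (simp add: sum_distrib_left)
  also have "\<dots> = (\<Sum>i\<le>k. (\<Sum>j\<le>k. g j * real (j choose i)) * (- u) ^ i)"
    unfolding sum_distrib_right mult.assoc by (rule sum.swap)
  finally have "jacobi_poly k \<alpha> b (2 * u - 1) =
     (\<Sum>i\<le>k. pochhammer A k / fact k * ((\<Sum>j\<le>k. g j * real (j choose i)) * (- u) ^ i))"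
    by (simp add: sum_distrib_left)
  also have "\<dots> = (\<Sum>i\<le>k. (-1) ^ k * pochhammer (- real k) i * pochhammer (real k + \<alpha> + b + 1) i
       * pochhammer (b + 1 + real i) (k - i) / (fact k * fact i) * u ^ i)"
  proof (rule sum.cong[OF refl])
    fix i assume "i \<in> {..k}"
    then have i: "i \<le> k" by simp
    have "(-1) ^ k = (-1) ^ i * ((-1) ^ (k - i) :: real)" using i by (simp flip: power_add)
    then have sign: "(- u) ^ i * (-1) ^ (k - i) = (-1) ^ k * u ^ i"
      by (simp add: power_minus[of u] mult_ac)
    have "pochhammer A k \<noteq> 0" using poch_pos[of 0 k] by simp
    then have "pochhammer A k / fact k * ((\<Sum>j\<le>k. g j * real (j choose i)) * (- u) ^ i) =
       pochhammer (- real k) i * pochhammer B i * pochhammer (b + 1 + real i) (k - i)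
         / (fact k * fact i) * ((- u) ^ i * (-1) ^ (k - i))"
      unfolding shift[OF i] AB[OF i] by simp
    then show "pochhammer A k / fact k * ((\<Sum>j\<le>k. g j * real (j choose i)) * (- u) ^ i) =
       (-1) ^ k * pochhammer (- real k) i * pochhammer (real k + \<alpha> + b + 1) i
       * pochhammer (b + 1 + real i) (k - i) / (fact k * fact i) * u ^ i"
      unfolding sign B_def by (simp add: mult_ac)
  qed
  finally show ?thesis .
qed

text \<open>The coefficients take the shape of those in \<open>jacobi_poly_reflect\<close>, so that
  the two expansions can be compared term by term: they differ only by \<open>(-1) ^ k\<close> and
  by the factor \<open>pochhammer (real k + \<alpha> + b + 1) i\<close>, which grows like
  \<open>\<alpha> ^ i\<close>.\<close>

lemma laguerre_poly_pochhammer: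
  "laguerre_poly k b y = (\<Sum>i\<le>k. pochhammer (- real k) i * pochhammer (b + 1 + real i) (k - i)
     / (fact k * fact i) * y ^ i)"
  unfolding laguerre_poly_def
proof (rule sum.cong[OF refl])
  fix i assume "i \<in> {..k}"
  then have i: "i \<le> k" by simp
  have "pochhammer (- real k) i = (-1) ^ i * pochhammer (real (k - i) + 1) i"
    using i by (simp add: pochhammer_minus of_nat_diff)
  also have "pochhammer (real (k - i) + 1) i = fact k / fact (k - i)"
    using i pochhammer_product[of "k - i" k "1::real"] by (simp add: pochhammer_fact[symmetric] add.commute)
  finally have 1: "pochhammer (- real k) i = (-1) ^ i * (fact k / fact (k - i))" .
  have "(real k + b) gchoose (k - i) = pochhammer (b + 1 + real i) (k - i) / fact (k - i)"
    using i by (simp add: gbinomial_pochhammer' of_nat_diff algebra_simps)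
  then show "(-1) ^ i * ((real k + b) gchoose (k - i)) * y ^ i / fact i =
     pochhammer (- real k) i * pochhammer (b + 1 + real i) (k - i) / (fact k * fact i) * y ^ i"
    unfolding 1 by (simp add: field_simps)
qed

section \<open>Rescaled Gegenbauer polynomials for large \<open>\<gamma>\<close>\<close>

lemma pochhammer_over_power_tendsto:
  "((\<lambda>\<gamma>. pochhammer (\<gamma> + c) j / \<gamma> ^ j) \<longlongrightarrow> (1::real)) at_top"
proof (induction j)
  case (Suc j)
  have "((\<lambda>\<gamma>. 1 + (c + real j) / \<gamma>) \<longlongrightarrow> 1 + 0) at_top"
    by (intro tendsto_intros tendsto_divide_0[OF tendsto_const] filterlim_at_top_imp_at_infinity filterlim_ident)
  moreover have "\<forall>\<^sub>F \<gamma> in at_top. 1 + (c + real j) / \<gamma> = (\<gamma> + c + real j) / \<gamma>"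
    using eventually_gt_at_top[of 0] by eventually_elim (simp add: field_simps)
  ultimately have "((\<lambda>\<gamma>. (\<gamma> + c + real j) / \<gamma>) \<longlongrightarrow> 1) at_top"
    using Lim_transform_eventually by fastforce
  from tendsto_mult[OF Suc this] show ?case
    by (simp add: pochhammer_Suc mult_ac)
qed simp

text \<open>In the expansion in powers of \<open>t\<close>, term \<open>i\<close> has a Pochhammer
  factor of order \<open>\<gamma> ^ i\<close>, which the substitution
  \<open>t = s / sqrt \<gamma>\<close> compensates exactly. The remaining growth is common to all
  terms and goes into \<open>N\<close>. The last two conclusions ensure that the Hermite polynomial
  is nonzero.\<close>

lemma gen_gegenbauer_asymp:
  fixes a :: real and n :: nat
  assumes a: "a > - 1/2"
  obtains N :: "real \<Rightarrow> real" and e :: "nat \<Rightarrow> nat" and c :: "nat \<Rightarrow> real \<Rightarrow> real" and c0 :: "nat \<Rightarrow> real"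
  where "\<forall>\<^sub>F \<gamma> in at_top. N \<gamma> > 0 \<and>
      (\<forall>s. gen_gegenbauer n \<gamma> a (s / sqrt \<gamma>) = N \<gamma> * (\<Sum>i\<le>n div 2. c i \<gamma> * s ^ e i))"
    and "\<And>i. (c i \<longlongrightarrow> c0 i) at_top"
    and "\<And>s. gen_hermite n a s = (\<Sum>i\<le>n div 2. c0 i * s ^ e i)"
    and "inj e" "c0 (n div 2) \<noteq> 0"
proof -
  \<comment> \<open>Both parities are treated at once: \<open>r\<close> is the exponent of the extra
    factor \<open>t\<close>, and \<open>b\<close> is the second Jacobi parameter as well as the
    Laguerre parameter.\<close>
  define k r where "k = n div 2" and "r = n mod 2"
  define b where "b = a - 1/2 + real r"
  have n: "n = 2 * k + r" and r: "r = 0 \<or> r = 1" by (auto simp: k_def r_def)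
  define e where "e i = 2 * i + r" for i
  \<comment> \<open>The Hermite normalization \<open>2 ^ n * fact k\<close> is divided out of
    \<open>N\<close> and put into \<open>c0\<close>; \<open>sqrt \<gamma> ^ r\<close> comes from
    rescaling \<open>t ^ r\<close>. Each \<open>c i\<close> is then \<open>c0 i\<close> times two
    quotients that tend to 1.\<close>
  define N where "N \<gamma> = \<gamma> ^ (k + r) / (sqrt \<gamma> ^ r * pochhammer (a + 1/2) (k + r) * 2 ^ n * fact k)" for \<gamma>
  define c0 where "c0 i = (-1) ^ k * 2 ^ n * fact k *
     (pochhammer (- real k) i * pochhammer (b + 1 + real i) (k - i) / (fact k * fact i))" for i
  define c where "c i \<gamma> = c0 i * (pochhammer (\<gamma> + a) (k + r) / \<gamma> ^ (k + r))
     * (pochhammer (\<gamma> + (real k + b + 1/2)) i / \<gamma> ^ i)" for i \<gamma>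
  have G: "gen_gegenbauer n \<gamma> a t = pochhammer (\<gamma> + a) (k + r) / pochhammer (a + 1/2) (k + r)
             * t ^ r * jacobi_poly k (\<gamma> - 1/2) b (2 * t\<^sup>2 - 1)" for \<gamma> t
    using r by (auto simp: gen_gegenbauer_def b_def k_def r_def even_iff_mod_2_eq_zero Let_def add.commute)
  have H: "gen_hermite n a s = (-1) ^ k * 2 ^ n * fact k * s ^ r * laguerre_poly k b (s\<^sup>2)" for s
    using r n by (auto simp: gen_hermite_def b_def k_def even_iff_mod_2_eq_zero Let_def add.commute)
  have scaled: "N \<gamma> > 0 \<and> (\<forall>s. gen_gegenbauer n \<gamma> a (s / sqrt \<gamma>) = N \<gamma> * (\<Sum>i\<le>k. c i \<gamma> * s ^ e i))"
    if g: "\<gamma> > 0" for \<gamma>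
  proof
    have P: "pochhammer (a + 1/2) (k + r) > 0" using a by (intro pochhammer_pos) auto
    show "N \<gamma> > 0" using g P by (simp add: N_def)
    show "\<forall>s. gen_gegenbauer n \<gamma> a (s / sqrt \<gamma>) = N \<gamma> * (\<Sum>i\<le>k. c i \<gamma> * s ^ e i)"
    proof
      fix s
      have t: "(s / sqrt \<gamma>)\<^sup>2 = s\<^sup>2 / \<gamma>" using g by (simp add: power_divide)
      have "\<gamma> - 1/2 > -1" using g by simp
      note J = jacobi_poly_reflect[OF this, of k b "s\<^sup>2 / \<gamma>"]
      have arg: "real k + (\<gamma> - 1/2) + b + 1 = \<gamma> + (real k + b + 1/2)" by simp
      show "gen_gegenbauer n \<gamma> a (s / sqrt \<gamma>) = N \<gamma> * (\<Sum>i\<le>k. c i \<gamma> * s ^ e i)"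
        unfolding G t J sum_distrib_left arg
      proof (rule sum.cong[OF refl])
        fix i
        have "(s / sqrt \<gamma>) ^ r = s ^ r / sqrt \<gamma> ^ r" "(s\<^sup>2 / \<gamma>) ^ i = s ^ (2 * i) / \<gamma> ^ i"
          by (simp_all add: power_divide power_mult)
        then show "pochhammer (\<gamma> + a) (k + r) / pochhammer (a + 1/2) (k + r) * (s / sqrt \<gamma>) ^ r *
           ((-1) ^ k * pochhammer (- real k) i * pochhammer (\<gamma> + (real k + b + 1/2)) i
             * pochhammer (b + 1 + real i) (k - i) / (fact k * fact i) * (s\<^sup>2 / \<gamma>) ^ i)
           = N \<gamma> * (c i \<gamma> * s ^ e i)"
          using g P by (simp add: N_def c_def c0_def e_def power_add field_simps)
      qed
    qed
  qed
  show ?thesis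
  proof
    show "\<forall>\<^sub>F \<gamma> in at_top. N \<gamma> > 0 \<and>
      (\<forall>s. gen_gegenbauer n \<gamma> a (s / sqrt \<gamma>) = N \<gamma> * (\<Sum>i\<le>n div 2. c i \<gamma> * s ^ e i))"
      using eventually_gt_at_top[of 0] by eventually_elim (use scaled in \<open>simp add: k_def\<close>)
    have "((\<lambda>\<gamma>. c i \<gamma>) \<longlongrightarrow> c0 i * 1 * 1) at_top" for i
      unfolding c_def by (intro tendsto_mult tendsto_const pochhammer_over_power_tendsto)
    then show "(c i \<longlongrightarrow> c0 i) at_top" for i by simp
    show "gen_hermite n a s = (\<Sum>i\<le>n div 2. c0 i * s ^ e i)" for s
      unfolding H laguerre_poly_pochhammer sum_distrib_left k_def[symmetric]
      by (intro sum.cong refl) (simp add: c0_def e_def power_add mult_ac flip: power_mult)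
    show "inj e" by (auto simp: inj_on_def e_def)
    show "c0 (n div 2) \<noteq> 0" by (simp add: c0_def k_def pochhammer_same)
  qed
qed

subsection \<open>Integrals on the line\<close>

text \<open>On each half-line the integrand is dominated by a multiple of the Gamma integrand
  \<open>s powr p / exp s\<close>, which converges at 0 because \<open>p > -1\<close>.\<close>

lemma integrable_powr_gauss:
  assumes p: "p > -1"
  shows "integrable lborel (\<lambda>s::real. \<bar>s\<bar> powr p * exp (- (s\<^sup>2) / 2))"
proof -
  define g where "g s = indicator {0..} s * (s powr p / exp s)" for s :: real
  have "((\<lambda>t. t powr (p + 1 - 1) / exp t) has_integral Gamma (p + 1)) {0..}"
    by (rule Gamma_integral_real) (use p in simp)
  then have "(\<lambda>t. t powr p / exp t) integrable_on {0..}" by (auto simp: has_integral_iff)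
  then have "(\<lambda>t. t powr p / exp t) absolutely_integrable_on {0..}"
    by (intro nonnegative_absolutely_integrable_1) auto
  then have "integrable lebesgue g"
    by (simp add: g_def[abs_def] set_integrable_def)
  then have g: "integrable lborel g"
    by (subst (asm) integrable_completion) (simp_all add: g_def[abs_def])
  have "integrable lborel (\<lambda>s. g (0 + (-1) * s))"
    by (rule lborel_integrable_real_affine[OF g]) simp
  then have "integrable lborel (\<lambda>s. exp (1/2) * (g s + g (- s)))"
    using g by (intro integrable_mult_right Bochner_Integration.integrable_add) simp_all
  then show ?thesis
  proof (rule Bochner_Integration.integrable_bound)
    show "(\<lambda>s::real. \<bar>s\<bar> powr p * exp (- (s\<^sup>2) / 2)) \<in> borel_measurable lborel" by measurable
    show "AE s in lborel. norm (\<bar>s\<bar> powr p * exp (- (s\<^sup>2) / 2)) \<le> norm (exp (1/2) * (g s + g (- s)))"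
    proof (rule AE_I2)
      fix s :: real
      \<comment> \<open>Completing the square compares the Gaussian with
        \<open>exp (- \<bar>s\<bar>)\<close>; this is where the constant \<open>exp (1/2)\<close>
        comes from.\<close>
      have "(\<bar>s\<bar> - 1)\<^sup>2 \<ge> 0" by simp
      then have "- (s\<^sup>2) / 2 \<le> 1/2 + - \<bar>s\<bar>" by (simp add: power2_diff)
      then have "exp (- (s\<^sup>2) / 2) \<le> exp (1/2 + - \<bar>s\<bar>)" by (simp only: exp_le_cancel_iff)
      also have "\<dots> = exp (1/2) / exp \<bar>s\<bar>" by (simp only: exp_add exp_minus divide_inverse)
      finally have "\<bar>s\<bar> powr p * exp (- (s\<^sup>2) / 2) \<le> \<bar>s\<bar> powr p * (exp (1/2) / exp \<bar>s\<bar>)"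
        by (intro mult_left_mono) auto
      also have "\<dots> = exp (1/2) * (\<bar>s\<bar> powr p / exp \<bar>s\<bar>)" by simp
      also have "\<bar>s\<bar> powr p / exp \<bar>s\<bar> \<le> g s + g (- s)"
        by (cases "s \<ge> 0") (auto simp: g_def indicator_def)
      finally have "\<bar>s\<bar> powr p * exp (- (s\<^sup>2) / 2) \<le> exp (1/2) * (g s + g (- s))" by simp
      moreover have "0 \<le> g s + g (- s)" by (simp add: g_def)
      ultimately show "norm (\<bar>s\<bar> powr p * exp (- (s\<^sup>2) / 2)) \<le> norm (exp (1/2) * (g s + g (- s)))"
        by (simp add: abs_mult)
    qed
  qed
qed

text \<open>Expanding the square leaves finitely many integrals of the preceding kind, with
  exponents at least \<open>p\<close>. Powers of \<open>\<bar>s\<bar>\<close> instead of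
  \<open>s\<close> let the monomials merge with \<open>\<bar>s\<bar> powr p\<close> and suit the use
  as a majorant.\<close>

lemma integrable_poly_powr_gauss:
  fixes e :: "nat \<Rightarrow> nat" and p :: real
  assumes p: "p > -1"
  shows "integrable lborel (\<lambda>s. (\<Sum>i\<le>K. d i * \<bar>s\<bar> ^ e i)\<^sup>2 * exp (- (s\<^sup>2) / 2) * \<bar>s\<bar> powr p)"
proof -
  have pw: "\<bar>s\<bar> ^ j * \<bar>s\<bar> powr p = \<bar>s\<bar> powr (p + real j)" for s :: real and j :: nat
    by (cases "s = 0") (simp_all add: powr_add powr_realpow)
  have "(\<Sum>i\<le>K. d i * \<bar>s\<bar> ^ e i)\<^sup>2 * exp (- (s\<^sup>2) / 2) * \<bar>s\<bar> powr p =
    (\<Sum>i\<le>K. \<Sum>j\<le>K. d i * d j * (\<bar>s\<bar> powr (p + real (e i + e j)) * exp (- (s\<^sup>2) / 2)))" for s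
  proof -
    have "d i * \<bar>s\<bar> ^ e i * (d j * \<bar>s\<bar> ^ e j) * exp (- (s\<^sup>2) / 2) * \<bar>s\<bar> powr p =
      d i * d j * (\<bar>s\<bar> powr (p + real (e i + e j)) * exp (- (s\<^sup>2) / 2))" for i j
      unfolding pw[symmetric] by (simp only: power_add mult_ac)
    then show ?thesis
      unfolding power2_eq_square[of "sum _ _"] sum_product unfolding sum_distrib_right by (simp only:)
  qed
  then show ?thesis
    using p by (simp only:) (intro Bochner_Integration.integrable_sum integrable_mult_right integrable_powr_gauss; simp)
qed

text \<open>The cutoff to \<open>[-1, 1]\<close> is part of the function, so that all integrals run
  over the whole line and the domain does not change under rescaling.\<close>

definition gegenbauer_weight :: "real \<Rightarrow> real \<Rightarrow> real" where
  "gegenbauer_weight \<gamma> t = (if \<bar>t\<bar> \<le> 1 then (1 - t\<^sup>2) powr (\<gamma> - 1/2) else 0)"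

lemma gegenbauer_weight_measurable [measurable]: "gegenbauer_weight \<gamma> \<in> borel_measurable borel"
  unfolding gegenbauer_weight_def by measurable

lemma gegenbauer_weight_nonneg [simp]: "0 \<le> gegenbauer_weight \<gamma> t"
  by (simp add: gegenbauer_weight_def)

lemma gegenbauer_weight_scaled_tendsto:
  "((\<lambda>\<gamma>. gegenbauer_weight \<gamma> (s / sqrt \<gamma>)) \<longlongrightarrow> exp (- (s\<^sup>2))) at_top"
proof -
  have "((\<lambda>\<gamma>. s\<^sup>2 / \<gamma>) \<longlongrightarrow> 0) at_top"
    by (intro tendsto_divide_0[OF tendsto_const] filterlim_at_top_imp_at_infinity filterlim_ident)
  then have "((\<lambda>\<gamma>. 1 + - (s\<^sup>2) / \<gamma>) \<longlongrightarrow> 1) at_top"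
    using tendsto_diff[OF tendsto_const[of 1]] by fastforce
  then have "((\<lambda>\<gamma>. (1 + - (s\<^sup>2) / \<gamma>) powr (- 1/2)) \<longlongrightarrow> 1 powr (- 1/2)) at_top"
    by (intro tendsto_powr tendsto_const) auto
  then have "((\<lambda>\<gamma>. (1 + - (s\<^sup>2) / \<gamma>) powr \<gamma> * (1 + - (s\<^sup>2) / \<gamma>) powr (- 1/2)) \<longlongrightarrow> exp (- (s\<^sup>2)) * 1) at_top"
    by (intro tendsto_mult tendsto_exp_limit_at_top) simp
  \<comment> \<open>For \<open>\<gamma> > s\<^sup>2\<close> the rescaled point lies inside the
    cutoff, and the exponent \<open>\<gamma> - 1/2\<close> splits into the part with an exponential
    limit and a part that tends to 1.\<close>
  moreover have "\<forall>\<^sub>F \<gamma> in at_top. (1 + - (s\<^sup>2) / \<gamma>) powr \<gamma> * (1 + - (s\<^sup>2) / \<gamma>) powr (- 1/2)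
      = gegenbauer_weight \<gamma> (s / sqrt \<gamma>)"
    using eventually_gt_at_top[of "s\<^sup>2"]
  proof eventually_elim
    case (elim \<gamma>)
    then have g: "\<gamma> > 0" using zero_le_power2[of s] by linarith
    have sq: "(s / sqrt \<gamma>)\<^sup>2 = s\<^sup>2 / \<gamma>" using g by (simp add: power_divide)
    have "(s / sqrt \<gamma>)\<^sup>2 \<le> 1" unfolding sq using elim g by simp
    then have "\<bar>s / sqrt \<gamma>\<bar> \<le> 1" by (simp only: abs_square_le_1)
    then show ?case
      by (simp add: gegenbauer_weight_def sq flip: powr_add)
  qed
  ultimately show ?thesis
    using Lim_transform_eventually by fastforce
qed

text \<open>With \<open>u = s\<^sup>2 / \<gamma>\<close>, the bound
  \<open>1 - u \<le> exp (- u)\<close> gives the exponent \<open>- u * (\<gamma> - 1/2)\<close>, and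
  \<open>\<gamma> - 1/2 \<ge> \<gamma> / 2\<close> for \<open>\<gamma> \<ge> 1\<close>.\<close>

lemma gegenbauer_weight_scaled_le:
  assumes "\<gamma> \<ge> 1"
  shows "gegenbauer_weight \<gamma> (s / sqrt \<gamma>) \<le> exp (- (s\<^sup>2) / 2)"
proof (cases "\<bar>s / sqrt \<gamma>\<bar> \<le> 1")
  case True
  define u where "u = s\<^sup>2 / \<gamma>"
  have sq: "(s / sqrt \<gamma>)\<^sup>2 = u" using assms by (simp add: power_divide u_def)
  have u: "0 \<le> u" "u \<le> 1"
    using True assms abs_square_le_1[of "s / sqrt \<gamma>"] unfolding sq by (simp_all add: u_def)
  have "(1 - u) powr (\<gamma> - 1/2) \<le> exp (- u) powr (\<gamma> - 1/2)"
    using u assms exp_ge_add_one_self[of "- u"] by (intro powr_mono2) auto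
  also have "\<dots> = exp (- u * (\<gamma> - 1/2))" by (simp add: exp_powr_real)
  also have "\<dots> \<le> exp (- (s\<^sup>2) / 2)"
  proof -
    have "s\<^sup>2 = u * \<gamma>" using assms by (simp add: u_def)
    moreover have "u * 1 \<le> u * \<gamma>" using u assms by (intro mult_left_mono) auto
    ultimately show ?thesis by (simp add: algebra_simps)
  qed
  finally show ?thesis using True sq by (simp add: gegenbauer_weight_def)
qed (simp add: gegenbauer_weight_def)

text \<open>Dominated convergence: each coefficient is eventually below
  \<open>\<bar>c0 i\<bar> + 1\<close> in absolute value, there are finitely many of them, and the
  weight is below a fixed Gaussian.\<close>

lemma gegenbauer_integral_tendsto:
  fixes e :: "nat \<Rightarrow> nat" and c :: "nat \<Rightarrow> real \<Rightarrow> real"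
  assumes p: "p > -1" and c: "\<And>i. (c i \<longlongrightarrow> c0 i) at_top"
  shows "((\<lambda>\<gamma>. LINT s|lborel. (\<Sum>i\<le>K. c i \<gamma> * s ^ e i)\<^sup>2 * gegenbauer_weight \<gamma> (s / sqrt \<gamma>) * \<bar>s\<bar> powr p)
    \<longlongrightarrow> (LINT s|lborel. (\<Sum>i\<le>K. c0 i * s ^ e i)\<^sup>2 * exp (- (s\<^sup>2)) * \<bar>s\<bar> powr p)) at_top"
proof (rule integral_dominated_convergence_at_top)
  let ?w = "\<lambda>s. (\<Sum>i\<le>K. (\<bar>c0 i\<bar> + 1) * \<bar>s\<bar> ^ e i)\<^sup>2 * exp (- (s\<^sup>2) / 2) * \<bar>s\<bar> powr p"
  show "integrable lborel ?w" by (rule integrable_poly_powr_gauss[OF p])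
  have "\<forall>\<^sub>F \<gamma> in at_top. \<bar>c i \<gamma>\<bar> < \<bar>c0 i\<bar> + 1" for i
    by (rule order_tendstoD[OF tendsto_rabs[OF c]]) simp
  then have "\<forall>\<^sub>F \<gamma> in at_top. \<forall>i\<in>{..K}. \<bar>c i \<gamma>\<bar> < \<bar>c0 i\<bar> + 1"
    by (subst eventually_ball_finite_distrib) auto
  then show "\<forall>\<^sub>F \<gamma> in at_top. AE s in lborel. norm ((\<Sum>i\<le>K. c i \<gamma> * s ^ e i)\<^sup>2 *
      gegenbauer_weight \<gamma> (s / sqrt \<gamma>) * \<bar>s\<bar> powr p) \<le> ?w s"
    using eventually_ge_at_top[of 1]
  proof eventually_elim
    case (elim \<gamma>)
    show ?case
    proof (rule AE_I2)
      fix s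
      have "\<bar>\<Sum>i\<le>K. c i \<gamma> * s ^ e i\<bar> \<le> (\<Sum>i\<le>K. \<bar>c i \<gamma> * s ^ e i\<bar>)" by (rule sum_abs)
      also have "\<dots> \<le> (\<Sum>i\<le>K. (\<bar>c0 i\<bar> + 1) * \<bar>s\<bar> ^ e i)"
        unfolding abs_mult power_abs using elim(1) by (intro sum_mono mult_right_mono) (auto intro: less_imp_le)
      finally have "(\<Sum>i\<le>K. c i \<gamma> * s ^ e i)\<^sup>2 \<le> (\<Sum>i\<le>K. (\<bar>c0 i\<bar> + 1) * \<bar>s\<bar> ^ e i)\<^sup>2"
        by (rule abs_le_square_iff[THEN iffD1, OF order_trans[OF _ abs_ge_self]])
      then show "norm ((\<Sum>i\<le>K. c i \<gamma> * s ^ e i)\<^sup>2 *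
          gegenbauer_weight \<gamma> (s / sqrt \<gamma>) * \<bar>s\<bar> powr p) \<le> ?w s"
        using mult_right_mono[OF mult_mono[OF _ gegenbauer_weight_scaled_le[OF elim(2), of s]], where c="\<bar>s\<bar> powr p"]
        by (simp add: abs_of_nonneg)
    qed
  qed
  show "AE s in lborel. ((\<lambda>\<gamma>. (\<Sum>i\<le>K. c i \<gamma> * s ^ e i)\<^sup>2 * gegenbauer_weight \<gamma> (s / sqrt \<gamma>) * \<bar>s\<bar> powr p)
    \<longlongrightarrow> (\<Sum>i\<le>K. c0 i * s ^ e i)\<^sup>2 * exp (- (s\<^sup>2)) * \<bar>s\<bar> powr p) at_top"
    by (intro AE_I2 tendsto_intros c gegenbauer_weight_scaled_tendsto)
qed measurable

text \<open>Since \<open>e\<close> is injective, no two monomials merge, and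
  \<open>c i0 \<noteq> 0\<close> makes the polynomial nonzero. Its roots are finite in number, so
  the nonnegative integrand is positive almost everywhere.\<close>

lemma hermite_integral_pos:
  fixes e :: "nat \<Rightarrow> nat" and c :: "nat \<Rightarrow> real"
  assumes p: "p > -1" and e: "inj e" and i0: "i0 \<le> K" "c i0 \<noteq> 0"
  shows "0 < (LINT s|lborel. (\<Sum>i\<le>K. c i * s ^ e i)\<^sup>2 * exp (- (s\<^sup>2)) * \<bar>s\<bar> powr p)"
    (is "0 < integral\<^sup>L lborel ?f")
proof -
  have int: "integrable lborel ?f"
  proof (rule Bochner_Integration.integrable_bound[OF integrable_poly_powr_gauss[OF p, where K=K and e=e and d="\<lambda>i. \<bar>c i\<bar>"]])
    show "?f \<in> borel_measurable lborel" by measurable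
    have "norm (?f s) \<le> norm ((\<Sum>i\<le>K. \<bar>c i\<bar> * \<bar>s\<bar> ^ e i)\<^sup>2 * exp (- (s\<^sup>2) / 2) * \<bar>s\<bar> powr p)" for s
    proof -
      have "\<bar>\<Sum>i\<le>K. c i * s ^ e i\<bar> \<le> (\<Sum>i\<le>K. \<bar>c i * s ^ e i\<bar>)" by (rule sum_abs)
      then have "(\<Sum>i\<le>K. c i * s ^ e i)\<^sup>2 \<le> (\<Sum>i\<le>K. \<bar>c i\<bar> * \<bar>s\<bar> ^ e i)\<^sup>2"
        unfolding abs_mult power_abs by (rule abs_le_square_iff[THEN iffD1, OF order_trans[OF _ abs_ge_self]])
      moreover have "exp (- (s\<^sup>2)) \<le> exp (- (s\<^sup>2) / 2)" by simp
      ultimately show ?thesis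
        using mult_right_mono[OF mult_mono, where c="\<bar>s\<bar> powr p"] by (simp add: abs_of_nonneg)
    qed
    then show "AE s in lborel. norm (?f s) \<le> norm ((\<Sum>i\<le>K. \<bar>c i\<bar> * \<bar>s\<bar> ^ e i)\<^sup>2 * exp (- (s\<^sup>2) / 2) * \<bar>s\<bar> powr p)"
      by (rule AE_I2)
  qed
  define q where "q = (\<Sum>i\<le>K. monom (c i) (e i))"
  have q: "poly q s = (\<Sum>i\<le>K. c i * s ^ e i)" for s
    by (simp add: q_def poly_sum poly_monom)
  have "coeff q (e i0) = (\<Sum>i\<le>K. if i = i0 then c i else 0)"
    using e by (auto simp: q_def coeff_sum inj_eq intro!: sum.cong)
  then have "q \<noteq> 0" using i0 by auto
  \<comment> \<open>The point 0 is added to the exceptional set because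
    \<open>0 powr p = 0\<close>.\<close>
  then have "finite ({s. poly q s = 0} \<union> {0})" using poly_roots_finite by auto
  then have "AE s in lborel. s \<notin> {s. poly q s = 0} \<union> {0}"
    by (intro AE_not_in finite_imp_null_set_lborel)
  then have nz: "AE s in lborel. ?f s \<noteq> 0"
    by eventually_elim (simp add: q)
  have "integral\<^sup>L lborel ?f \<noteq> 0"
  proof
    assume "integral\<^sup>L lborel ?f = 0"
    then have "AE s in lborel. ?f s = 0"
      by (subst (asm) integral_nonneg_eq_0_iff_AE[OF int]) auto
    with nz have "AE s :: real in lborel. False" by eventually_elim simp
    then show False
      using AE_iff_measurable[of UNIV "lborel :: real measure" "\<lambda>_. False"] by simp
  qed
  moreover have "integral\<^sup>L lborel ?f \<ge> 0" by (intro integral_nonneg_AE AE_I2) simp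
  ultimately show ?thesis by linarith
qed

text \<open>It suffices to rule out integrability of \<open>1 / s\<close> on
  \<open>(0, 1/2]\<close>. By scale invariance of \<open>ds / s\<close>, that integral would equal
  the one over \<open>(0, 1]\<close>, although the two differ by a positive amount.\<close>

lemma not_integrable_powr_at_0:
  fixes f :: "real \<Rightarrow> real"
  assumes C: "C > 0" and p: "p \<le> -1"
    and le: "\<And>s. 0 < s \<Longrightarrow> s \<le> 1/2 \<Longrightarrow> C * s powr p \<le> f s"
  shows "\<not> integrable lborel f"
proof
  assume f: "integrable lborel f"
  define h where "h s = indicator {0<..1/2} s / s" for s :: real
  have "integrable lborel (\<lambda>s. f s / C)" using f by simp
  then have h: "integrable lborel h"
  proof (rule Bochner_Integration.integrable_bound)
    show "h \<in> borel_measurable lborel" unfolding h_def by measurable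
    have "norm (h s) \<le> norm (f s / C)" for s
    proof (cases "0 < s \<and> s \<le> 1/2")
      case True
      then have "1 / s = s powr (-1)" by (simp add: powr_minus_divide)
      also have "\<dots> \<le> s powr p" using True p by (intro powr_mono') auto
      also have "\<dots> \<le> f s / C" using le[of s] True C by (simp add: field_simps)
      finally have "1 / s \<le> f s / C" .
      then have "1 / s \<le> \<bar>f s / C\<bar>" by linarith
      then show ?thesis using True by (simp add: h_def)
    qed (auto simp: h_def)
    then show "AE s in lborel. norm (h s) \<le> norm (f s / C)" by simp
  qed
  have h2: "integrable lborel (\<lambda>s. h (0 + 1/2 * s))"
    by (rule lborel_integrable_real_affine[OF h]) simp
  have "integral\<^sup>L lborel h = \<bar>1/2\<bar> *\<^sub>R (\<integral>s. h (0 + 1/2 * s) \<partial>lborel)"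
    by (rule lborel_integral_real_affine) simp
  then have zero: "(\<integral>s. 1/2 * h (0 + 1/2 * s) - h s \<partial>lborel) = 0"
    using h h2 by simp
  \<comment> \<open>The difference is \<open>1 / s\<close> on \<open>(1/2, 1]\<close> and 0
    elsewhere, hence at least the indicator.\<close>
  have "(\<integral>s. indicator {1/2<..1::real} s \<partial>lborel) \<le> (\<integral>s. 1/2 * h (0 + 1/2 * s) - h s \<partial>lborel)"
  proof (rule integral_mono)
    show "integrable lborel (\<lambda>s. 1/2 * h (0 + 1/2 * s) - h s)"
      using h h2 by (intro Bochner_Integration.integrable_diff integrable_mult_right)
    show "integrable lborel (indicator {1/2<..1::real} :: real \<Rightarrow> real)"
      by (rule integrable_real_indicator) (simp_all add: less_top[symmetric])
    show "indicator {1/2<..1} s \<le> 1/2 * h (0 + 1/2 * s) - h s" for s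
      by (auto simp: h_def indicator_def field_simps)
  qed
  then show False unfolding zero by simp
qed

subsection \<open>Integrals on the cone\<close>

lemma nn_integral_lborel_scaleR:
  fixes G :: "'a::euclidean_space \<Rightarrow> ennreal"
  assumes [measurable]: "G \<in> borel_measurable borel" and "c \<noteq> 0"
  shows "(\<integral>\<^sup>+x. G x \<partial>lborel) = ennreal (\<bar>c\<bar> ^ DIM('a)) * (\<integral>\<^sup>+x. G (c *\<^sub>R x) \<partial>lborel)"
  by (subst lborel_affine[OF assms(2), of 0])
    (simp add: nn_integral_density nn_integral_distr nn_integral_cmult)

text \<open>Working with \<^const>\<open>nn_integral\<close> makes the product formula hold without any integrability
  assumption: if one of the factors on the right is not integrable, both sides are 0.\<close>

lemma integral_homogeneous:
  fixes F :: "real \<Rightarrow> real" and q :: "'a::euclidean_space \<Rightarrow> real \<Rightarrow> real"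
  assumes [measurable]: "F \<in> borel_measurable borel"
      "(\<lambda>z. q (fst z) (snd z)) \<in> borel_measurable (borel :: ('a \<times> real) measure)"
    and F: "\<And>t. 0 \<le> F t" and q: "\<And>x t. 0 \<le> q x t"
    and hom: "\<And>x t. t \<noteq> 0 \<Longrightarrow> q (t *\<^sub>R x) t = \<bar>t\<bar> powr r * q x 1"
  shows "(LINT z|lborel. F (snd z) * q (fst z) (snd z)) =
    (LINT t|lborel. F t * \<bar>t\<bar> powr (r + real DIM('a))) * (LINT x|lborel. q x 1)"
proof -
  have qt [measurable]: "(\<lambda>x. q x t) \<in> borel_measurable borel" for t
  proof -
    have "(\<lambda>x. (x, t)) \<in> borel_measurable (borel :: 'a measure)"
      by (intro borel_measurable_continuous_onI continuous_intros)
    from measurable_compose[OF this assms(2)] show ?thesis by simp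
  qed
  have inner: "(\<integral>\<^sup>+x. ennreal (F t * q x t) \<partial>lborel) =
      ennreal (F t * \<bar>t\<bar> powr (r + real DIM('a))) * (\<integral>\<^sup>+x. ennreal (q x 1) \<partial>lborel)" if t: "t \<noteq> 0" for t
  proof -
    have "(\<integral>\<^sup>+x. ennreal (F t * q x t) \<partial>lborel) =
        ennreal (\<bar>t\<bar> ^ DIM('a)) * (\<integral>\<^sup>+x. ennreal (F t * q (t *\<^sub>R x) t) \<partial>lborel)"
      by (rule nn_integral_lborel_scaleR) (use t in simp_all)
    also have "(\<integral>\<^sup>+x. ennreal (F t * q (t *\<^sub>R x) t) \<partial>lborel) =
        (\<integral>\<^sup>+x. ennreal (F t * \<bar>t\<bar> powr r) * ennreal (q x 1) \<partial>lborel)"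
      using F q t by (simp add: hom ennreal_mult mult.assoc)
    also have "\<dots> = ennreal (F t * \<bar>t\<bar> powr r) * (\<integral>\<^sup>+x. ennreal (q x 1) \<partial>lborel)"
      by (rule nn_integral_cmult) simp
    also have "ennreal (\<bar>t\<bar> ^ DIM('a)) * (ennreal (F t * \<bar>t\<bar> powr r) * (\<integral>\<^sup>+x. ennreal (q x 1) \<partial>lborel)) =
        ennreal (F t * \<bar>t\<bar> powr (r + real DIM('a))) * (\<integral>\<^sup>+x. ennreal (q x 1) \<partial>lborel)"
      using F t by (simp add: powr_add powr_realpow ennreal_mult mult_ac)
    finally show ?thesis .
  qed
  have meas: "(\<lambda>z. F (snd z) * q (fst z) (snd z)) \<in> borel_measurable (lborel :: ('a \<times> real) measure)"
  proof -
    have [measurable]: "snd \<in> borel_measurable (borel :: ('a \<times> real) measure)"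
      by (intro borel_measurable_continuous_onI continuous_intros)
    show ?thesis by measurable
  qed
  have "(LINT z|lborel. F (snd z) * q (fst z) (snd z)) =
      enn2real (\<integral>\<^sup>+z. ennreal (F (snd z) * q (fst z) (snd z)) \<partial>(lborel :: ('a \<times> real) measure))"
    by (rule integral_eq_nn_integral[OF meas]) (use F q in simp)
  also have "(\<integral>\<^sup>+z. ennreal (F (snd z) * q (fst z) (snd z)) \<partial>(lborel :: ('a \<times> real) measure)) =
      (\<integral>\<^sup>+t. \<integral>\<^sup>+x. ennreal (F t * q x t) \<partial>lborel \<partial>lborel)"
    unfolding lborel_prod[symmetric]
    by (subst lborel_pair.nn_integral_snd[symmetric]) (use measurable_compose[OF meas measurable_ennreal] in \<open>simp_all only: lborel_prod fst_conv snd_conv\<close>)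
  \<comment> \<open>The substitution in the inner integral fails only on the slice
    \<open>t = 0\<close>, a null set.\<close>
  also have "\<dots> = (\<integral>\<^sup>+t. ennreal (F t * \<bar>t\<bar> powr (r + real DIM('a))) * (\<integral>\<^sup>+x. ennreal (q x 1) \<partial>lborel) \<partial>lborel)"
    by (rule nn_integral_cong_AE, use AE_lborel_singleton[of 0] in eventually_elim) (rule inner)
  also have "\<dots> = (\<integral>\<^sup>+t. ennreal (F t * \<bar>t\<bar> powr (r + real DIM('a))) \<partial>lborel) * (\<integral>\<^sup>+x. ennreal (q x 1) \<partial>lborel)"
    by (rule nn_integral_multc) measurable
  also have "enn2real \<dots> =
      (LINT t|lborel. F t * \<bar>t\<bar> powr (r + real DIM('a))) * (LINT x|lborel. q x 1)"
    using F q by (simp add: enn2real_mult integral_eq_nn_integral)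
  finally show ?thesis .
qed

text \<open>Every monomial has total degree \<open>m\<close> in \<open>(x, t)\<close>; the degree
  bound keeps the subtraction \<open>m - mdeg \<alpha>\<close> from being truncated.\<close>

lemma homogenize_scale:
  assumes "\<forall>\<alpha>\<in>Poly_Mapping.keys p. mdeg \<alpha> \<le> m"
  shows "homogenize m p (s *\<^sub>R x) (s * t) = s ^ m * homogenize m p x t"
  unfolding homogenize_def sum_distrib_left
proof (rule sum.cong[OF refl])
  fix \<alpha> assume "\<alpha> \<in> Poly_Mapping.keys p"
  then have "s ^ m = s ^ mdeg \<alpha> * s ^ (m - mdeg \<alpha>)" using assms by (simp flip: power_add)
  moreover have "(\<Prod>i\<in>UNIV. ((s *\<^sub>R x) $ i) ^ \<alpha> i) = s ^ mdeg \<alpha> * (\<Prod>i\<in>UNIV. (x $ i) ^ \<alpha> i)"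
    by (simp add: power_mult_distrib prod.distrib mdeg_def power_sum)
  ultimately show "Poly_Mapping.lookup p \<alpha> * (\<Prod>i\<in>UNIV. ((s *\<^sub>R x) $ i) ^ \<alpha> i) * (s * t) ^ (m - mdeg \<alpha>) =
      s ^ m * (Poly_Mapping.lookup p \<alpha> * (\<Prod>i\<in>UNIV. (x $ i) ^ \<alpha> i) * t ^ (m - mdeg \<alpha>))"
    by (simp add: power_mult_distrib mult_ac)
qed

lemma homogenize_1: "homogenize m p x 1 = meval p x"
  by (simp add: homogenize_def meval_def)

lemma continuous_on_homogenize: "continuous_on UNIV (\<lambda>z. homogenize m p (fst z) (snd z))"
  unfolding homogenize_def by (intro continuous_intros)

text \<open>Under \<open>x = t y\<close> the exponent of \<open>\<bar>t\<bar>\<close> collects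
  \<open>2 j\<close> from the square of \<open>u\<close>, \<open>2 \<mu> - 1\<close> from the weight
  and the dimension from the Jacobian. It serves for the constant 1 with \<open>j = 0\<close> and
  for the homogenized polynomial with \<open>j = m\<close>.\<close>

lemma cone_integral:
  fixes u :: "real ^ 'd::finite \<Rightarrow> real \<Rightarrow> real"
  assumes [measurable]: "F \<in> borel_measurable borel" and F: "\<And>t. 0 \<le> F t"
    and u: "continuous_on UNIV (\<lambda>z. u (fst z) (snd z))"
    and hom: "\<And>x t. u (t *\<^sub>R x) t = t ^ j * u x 1"
  shows "(LINT (x, t)|lborel. (if norm x \<le> \<bar>t\<bar> then (u x t)\<^sup>2 * F t * (t\<^sup>2 - (norm x)\<^sup>2) powr (\<mu> - 1/2) else 0)) =
    (LINT t|lborel. F t * \<bar>t\<bar> powr (2 * real j + 2 * \<mu> - 1 + real CARD('d))) *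
    (LINT x:cball 0 1|lborel. (u x 1)\<^sup>2 * (1 - (norm x)\<^sup>2) powr (\<mu> - 1/2))"
proof -
  define q where "q x t = (if norm x \<le> \<bar>t\<bar> then (u x t)\<^sup>2 * (t\<^sup>2 - (norm x)\<^sup>2) powr (\<mu> - 1/2) else 0)" for x t
  have u' [measurable]: "(\<lambda>z. u (fst z) (snd z)) \<in> borel_measurable borel"
    by (rule borel_measurable_continuous_onI[OF u])
  have q_scale: "q (t *\<^sub>R x) t = \<bar>t\<bar> powr (2 * real j + 2 * \<mu> - 1) * q x 1" if t: "t \<noteq> 0" for x t
  proof (cases "norm x \<le> 1")
    case True
    have "t\<^sup>2 - (norm (t *\<^sub>R x))\<^sup>2 = t\<^sup>2 * (1 - (norm x)\<^sup>2)"
      by (simp add: power_mult_distrib algebra_simps)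
    moreover have "0 \<le> 1 - (norm x)\<^sup>2" using True by (simp add: power_le_one)
    ultimately have "(t\<^sup>2 - (norm (t *\<^sub>R x))\<^sup>2) powr (\<mu> - 1/2) = (t\<^sup>2) powr (\<mu> - 1/2) * (1 - (norm x)\<^sup>2) powr (\<mu> - 1/2)"
      by (simp add: powr_mult)
    moreover have "(t\<^sup>2) powr (\<mu> - 1/2) = \<bar>t\<bar> powr (2 * \<mu> - 1)"
    proof -
      have "t\<^sup>2 = \<bar>t\<bar> powr 2" using t by simp
      then show ?thesis by (simp only: powr_powr) (simp add: algebra_simps)
    qed
    moreover have "(t ^ j)\<^sup>2 = \<bar>t\<bar> powr (2 * real j)"
    proof -
      have "\<bar>t\<bar> powr real (2 * j) = \<bar>t\<bar> ^ (2 * j)" using t by (intro powr_realpow) simp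
      then show ?thesis by (simp add: power_mult[symmetric] mult.commute power_even_abs)
    qed
    moreover have "\<bar>t\<bar> powr (2 * real j + 2 * \<mu> - 1) = \<bar>t\<bar> powr (2 * real j) * \<bar>t\<bar> powr (2 * \<mu> - 1)"
      by (simp flip: powr_add add: algebra_simps)
    ultimately show ?thesis
      using True t hom[of t x] by (simp add: q_def power_mult_distrib mult_le_cancel_left1)
  next
    case False
    then show ?thesis using t by (simp add: q_def mult_le_cancel_left1)
  qed
  have "(LINT (x, t)|lborel. (if norm x \<le> \<bar>t\<bar> then (u x t)\<^sup>2 * F t * (t\<^sup>2 - (norm x)\<^sup>2) powr (\<mu> - 1/2) else 0))
      = (LINT z|lborel. F (snd z) * q (fst z) (snd z))"
    by (intro Bochner_Integration.integral_cong) (auto simp: q_def)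
  also have "\<dots> = (LINT t|lborel. F t * \<bar>t\<bar> powr (2 * real j + 2 * \<mu> - 1 + real DIM(real ^ 'd))) * (LINT x|lborel. q x 1)"
  proof (rule integral_homogeneous)
    show "(\<lambda>z. q (fst z) (snd z)) \<in> borel_measurable (borel :: ((real ^ 'd) \<times> real) measure)"
    proof -
      have [measurable]: "fst \<in> borel_measurable (borel :: ((real ^ 'd) \<times> real) measure)"
          "snd \<in> borel_measurable (borel :: ((real ^ 'd) \<times> real) measure)"
        by (intro borel_measurable_continuous_onI continuous_intros)+
      show ?thesis unfolding q_def by measurable
    qed
  qed (use F q_scale in \<open>auto simp: q_def\<close>)
  also have "(LINT x|lborel. q x 1) = (LINT x:cball 0 1|lborel. (u x 1)\<^sup>2 * (1 - (norm x)\<^sup>2) powr (\<mu> - 1/2))"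
    unfolding set_lebesgue_integral_def
    by (intro Bochner_Integration.integral_cong) (auto simp: q_def indicator_def)
  finally show ?thesis by simp
qed

text \<open>Numerator and denominator both split off an integral over the ball, and these cancel by
  the normalization of \<open>p\<close>. Both cones are covered: \<open>V\<close> is
  \<open>gegenbauer_weight\<close> in one case and the Gaussian in the other, and \<open>S\<close>
  enters only through the product of its indicator with \<open>w\<close>.\<close>

lemma cone_normalized_integral:
  fixes p :: "'d::finite mpoly" and w :: "(real ^ 'd) \<times> real \<Rightarrow> real"
  assumes deg: "\<forall>\<alpha>\<in>Poly_Mapping.keys p. mdeg \<alpha> \<le> m" and p: "ball_inner \<mu> p p = 1"
    and [measurable]: "G \<in> borel_measurable borel" "V \<in> borel_measurable borel"
    and V: "\<And>t. 0 \<le> V t"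
    and w: "\<And>x t. indicator S (x, t) * w (x, t) =
      (if norm x \<le> \<bar>t\<bar> then V t * \<bar>t\<bar> powr (2 * \<beta>) * (t\<^sup>2 - (norm x)\<^sup>2) powr (\<mu> - 1/2) else 0)"
  shows "normalized_integral S w (\<lambda>(x, t). (G t * homogenize m p x t)\<^sup>2) =
    (LINT t|lborel. (G t)\<^sup>2 * V t * \<bar>t\<bar> powr (2 * cone_param CARD('d) \<beta> \<mu> m)) /
    (LINT t|lborel. V t * \<bar>t\<bar> powr (2 * cone_param CARD('d) \<beta> \<mu> m - 2 * real m))"
proof -
  define B where "B p' = (LINT x:cball 0 1|lborel. p' x * (1 - (norm x)\<^sup>2) powr (\<mu> - 1/2))"
    for p' :: "real ^ 'd \<Rightarrow> real"
  \<comment> \<open>As the product is 1, \<open>B (\<lambda>x. 1)\<close> is nonzero and the two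
    ball integrals are equal, so dividing by them is legitimate.\<close>
  have B: "1 / B (\<lambda>x. 1) * B (\<lambda>x. (meval p x)\<^sup>2) = 1"
    using p by (simp add: ball_inner_def normalized_integral_def B_def power2_eq_square)
  have e1: "2 * cone_param CARD('d) \<beta> \<mu> m - 2 * real m =
      2 * \<beta> + (2 * real 0 + 2 * \<mu> - 1 + real CARD('d))"
    and e2: "2 * cone_param CARD('d) \<beta> \<mu> m =
      2 * \<beta> + (2 * real m + 2 * \<mu> - 1 + real CARD('d))"
    by (simp_all add: cone_param_def)
  have "(LINT z:S|lborel. w z) = (LINT (x :: real ^ 'd, t)|lborel. (if norm x \<le> \<bar>t\<bar>
      then (1::real)\<^sup>2 * (V t * \<bar>t\<bar> powr (2 * \<beta>)) * (t\<^sup>2 - (norm x)\<^sup>2) powr (\<mu> - 1/2) else 0))"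
    unfolding set_lebesgue_integral_def
    by (rule Bochner_Integration.integral_cong[OF refl]) (auto simp: w)
  also have "\<dots> = (LINT t|lborel. V t * \<bar>t\<bar> powr (2 * cone_param CARD('d) \<beta> \<mu> m - 2 * real m)) * B (\<lambda>x. 1)"
    unfolding e1 powr_add[of _ "2 * \<beta>"]
    by (subst cone_integral[where j=0 and u="\<lambda>x t. 1"]) (simp_all add: V B_def mult_ac)
  finally have den: "(LINT z:S|lborel. w z) = \<dots>" .
  have "(LINT z:S|lborel. (case z of (x, t) \<Rightarrow> (G t * homogenize m p x t)\<^sup>2) * w z) =
    (LINT (x, t)|lborel. (if norm x \<le> \<bar>t\<bar> then (homogenize m p x t)\<^sup>2 * ((G t)\<^sup>2 * V t * \<bar>t\<bar> powr (2 * \<beta>))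
      * (t\<^sup>2 - (norm x)\<^sup>2) powr (\<mu> - 1/2) else 0))"
    unfolding set_lebesgue_integral_def
  proof (rule Bochner_Integration.integral_cong[OF refl], clarsimp simp only: split_paired_all prod.case)
    fix x :: "real ^ 'd" and t
    have "indicat_real S (x, t) *\<^sub>R ((G t * homogenize m p x t)\<^sup>2 * w (x, t)) =
        (G t * homogenize m p x t)\<^sup>2 * (indicat_real S (x, t) * w (x, t))" by simp
    also have "\<dots> = (if norm x \<le> \<bar>t\<bar> then (homogenize m p x t)\<^sup>2 * ((G t)\<^sup>2 * V t * \<bar>t\<bar> powr (2 * \<beta>))
          * (t\<^sup>2 - (norm x)\<^sup>2) powr (\<mu> - 1/2) else 0)"
      unfolding w by (simp add: power_mult_distrib)
    finally show "indicat_real S (x, t) *\<^sub>R ((G t * homogenize m p x t)\<^sup>2 * w (x, t)) = \<dots>" .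
  qed
  also have "\<dots> = (LINT t|lborel. (G t)\<^sup>2 * V t * \<bar>t\<bar> powr (2 * cone_param CARD('d) \<beta> \<mu> m)) * B (\<lambda>x. (meval p x)\<^sup>2)"
    unfolding e2 powr_add[of _ "2 * \<beta>"]
    \<comment> \<open>Homogeneity relative to the slice \<open>t = 1\<close> holds for every factor,
      including 0.\<close>
    using homogenize_scale[OF deg, where t=1]
    by (subst cone_integral[where j=m]) (simp_all add: V B_def homogenize_1 continuous_on_homogenize mult_ac)
  finally have num: "(LINT z:S|lborel. (case z of (x, t) \<Rightarrow> (G t * homogenize m p x t)\<^sup>2) * w z) = \<dots>" .
  show ?thesis
    unfolding normalized_integral_def num den using B by (simp add: field_simps)
qed

subsection \<open>The limit\<close>

theorem theorem7p9:
  fixes \<mu> \<beta> :: real and m n :: nat and k :: "'d::finite \<Rightarrow> nat"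
    and P :: "('d \<Rightarrow> nat) \<Rightarrow> 'd mpoly" and x :: "real ^ 'd" and t :: real
  assumes "\<mu> > - 1/2"
    and "\<beta> > - (real CARD('d) + 1) / 2"
    and "m \<le> n"
    and "mdeg k = m"
    and "ball_orthonormal_basis \<mu> m P"
  shows "((\<lambda>\<gamma>. cone_gegenbauer \<beta> \<gamma> \<mu> m n (P k) (x /\<^sub>R sqrt \<gamma>) (t / sqrt \<gamma>)
                  / sqrt (norm2_cone_gegenbauer \<beta> \<gamma> \<mu> m n (P k)))
          \<longlongrightarrow> cone_hermite \<beta> \<mu> m n (P k) x t / sqrt (norm2_cone_hermite \<beta> \<mu> m n (P k))) at_top"
proof -
  define p where "p = P k"
  define a where "a = cone_param CARD('d) \<beta> \<mu> m"
  define \<nu> where "\<nu> = n - m"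
  have deg: "\<forall>\<alpha>\<in>Poly_Mapping.keys p. mdeg \<alpha> \<le> m" and p: "ball_inner \<mu> p p = 1"
    using assms(4,5) by (auto simp: p_def ball_orthonormal_basis_def ball_orthogonal_polys_def)
  \<comment> \<open>The names \<open>K\<close> belong to the Gegenbauer weight and \<open>J\<close>
    to the Hermite weight; index 0 marks the integral for the constant 1, index 1 the one for the
    polynomial.\<close>
  define K0 where "K0 \<gamma> = (LINT t|lborel. gegenbauer_weight \<gamma> t * \<bar>t\<bar> powr (2 * a - 2 * real m))" for \<gamma>
  define K1 where "K1 \<gamma> = (LINT t|lborel. (gen_gegenbauer \<nu> \<gamma> a t)\<^sup>2 * gegenbauer_weight \<gamma> t * \<bar>t\<bar> powr (2 * a))" for \<gamma>
  define J0 where "J0 = (LINT t|lborel. exp (- (t\<^sup>2)) * \<bar>t\<bar> powr (2 * a - 2 * real m))"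
  define J1 where "J1 = (LINT t|lborel. (gen_hermite \<nu> a t)\<^sup>2 * exp (- (t\<^sup>2)) * \<bar>t\<bar> powr (2 * a))"
  have [measurable]: "gen_gegenbauer \<nu> \<gamma> a \<in> borel_measurable borel" for \<gamma>
    unfolding gen_gegenbauer_def jacobi_poly_def Let_def by measurable
  have [measurable]: "gen_hermite \<nu> a \<in> borel_measurable borel"
    unfolding gen_hermite_def laguerre_poly_def Let_def by measurable
  have hC: "norm2_cone_gegenbauer \<beta> \<gamma> \<mu> m n p = K1 \<gamma> / K0 \<gamma>" for \<gamma>
    unfolding norm2_cone_gegenbauer_def cone_gegenbauer_def K0_def K1_def a_def[symmetric] \<nu>_def[symmetric]
    unfolding a_def
    by (rule cone_normalized_integral[OF deg p])
      (auto simp: gegenbauer_weight_def indicator_def a_def[symmetric])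
  have hH: "norm2_cone_hermite \<beta> \<mu> m n p = J1 / J0"
    unfolding norm2_cone_hermite_def cone_hermite_def J0_def J1_def a_def[symmetric] \<nu>_def[symmetric]
    unfolding a_def
    by (rule cone_normalized_integral[OF deg p]) (auto simp: indicator_def a_def[symmetric])
  show ?thesis
  proof (cases "2 * a - 2 * real m > -1")
    \<comment> \<open>The exponent is too small for integrability at 0: \<open>J0\<close>, and
      \<open>K0 \<gamma>\<close> for \<open>\<gamma> \<ge> 1\<close>, are 0 by convention, and the
      divisions by 0 make both quotients 0.\<close>
    case False
    then have pw: "2 * a - 2 * real m \<le> -1" by simp
    have "\<not> integrable lborel (\<lambda>t. exp (- (t\<^sup>2)) * \<bar>t\<bar> powr (2 * a - 2 * real m))"
    proof (rule not_integrable_powr_at_0[OF _ pw, of "exp (-1)"])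
      fix s :: real assume s: "0 < s" "s \<le> 1/2"
      then have "s\<^sup>2 \<le> 1" by (intro power_le_one) auto
      then show "exp (-1) * s powr (2 * a - 2 * real m) \<le> exp (- (s\<^sup>2)) * \<bar>s\<bar> powr (2 * a - 2 * real m)"
        using s by (intro mult_mono) auto
    qed simp
    then have J0: "J0 = 0" unfolding J0_def by (rule not_integrable_integral_eq)
    have K0: "K0 \<gamma> = 0" if \<gamma>: "\<gamma> \<ge> 1" for \<gamma>
    proof -
      have "\<not> integrable lborel (\<lambda>t. gegenbauer_weight \<gamma> t * \<bar>t\<bar> powr (2 * a - 2 * real m))"
      \<comment> \<open>On \<open>(0, 1/2]\<close> one has \<open>1 - s\<^sup>2 \<ge> 3/4\<close>,
        and \<open>\<gamma> \<ge> 1\<close> makes the exponent \<open>\<gamma> - 1/2\<close>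
        nonnegative.\<close>
      proof (rule not_integrable_powr_at_0[OF _ pw, of "(3/4) powr (\<gamma> - 1/2)"])
        fix s :: real assume s: "0 < s" "s \<le> 1/2"
        then have "s\<^sup>2 \<le> (1/2)\<^sup>2" by (intro power_mono) auto
        then have "(3/4) powr (\<gamma> - 1/2) \<le> gegenbauer_weight \<gamma> s"
          using s \<gamma> by (auto simp: gegenbauer_weight_def power2_eq_square intro!: powr_mono2)
        then show "(3/4) powr (\<gamma> - 1/2) * s powr (2 * a - 2 * real m)
            \<le> gegenbauer_weight \<gamma> s * \<bar>s\<bar> powr (2 * a - 2 * real m)"
          using s by (intro mult_mono) auto
      qed simp
      then show ?thesis unfolding K0_def by (rule not_integrable_integral_eq)
    qed
    have "\<forall>\<^sub>F \<gamma> in at_top. 0 = cone_gegenbauer \<beta> \<gamma> \<mu> m n p (x /\<^sub>R sqrt \<gamma>) (t / sqrt \<gamma>)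
        / sqrt (norm2_cone_gegenbauer \<beta> \<gamma> \<mu> m n p)"
      using eventually_ge_at_top[of 1] by eventually_elim (simp add: hC K0)
    then show ?thesis
      unfolding p_def[symmetric] hH J0 by (simp add: tendsto_eventually eventually_mono)
  next
    case True
    then have a: "a > - 1/2" "2 * a > -1" by (simp_all add: add_strict_increasing2)
    obtain N e c c0 where N: "\<forall>\<^sub>F \<gamma> in at_top. N \<gamma> > 0 \<and>
          (\<forall>s. gen_gegenbauer \<nu> \<gamma> a (s / sqrt \<gamma>) = N \<gamma> * (\<Sum>i\<le>\<nu> div 2. c i \<gamma> * s ^ e i))"
      and c: "\<And>i. (c i \<longlongrightarrow> c0 i) at_top"
      and herm: "\<And>s. gen_hermite \<nu> a s = (\<Sum>i\<le>\<nu> div 2. c0 i * s ^ e i)"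
      and e: "inj (e :: nat \<Rightarrow> nat)" and c0: "c0 (\<nu> div 2) \<noteq> 0"
      by (rule gen_gegenbauer_asymp[OF a(1), of \<nu>]) blast
    define g where "g \<gamma> s = (\<Sum>i\<le>\<nu> div 2. c i \<gamma> * s ^ e i)" for \<gamma> s
    \<comment> \<open>\<open>L0\<close> and \<open>L1\<close> are \<open>K0\<close> and
      \<open>K1\<close> after \<open>t = s / sqrt \<gamma>\<close>, freed of the powers of
      \<open>\<gamma>\<close> and of \<open>N\<close>; unlike these they converge to positive
      limits.\<close>
    define L0 where "L0 \<gamma> = (LINT s|lborel. gegenbauer_weight \<gamma> (s / sqrt \<gamma>) * \<bar>s\<bar> powr (2 * a - 2 * real m))" for \<gamma>
    define L1 where "L1 \<gamma> = (LINT s|lborel. (g \<gamma> s)\<^sup>2 * gegenbauer_weight \<gamma> (s / sqrt \<gamma>) * \<bar>s\<bar> powr (2 * a))" for \<gamma>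
    have L0: "(L0 \<longlongrightarrow> J0) at_top"
      \<comment> \<open>The constant 1 is the polynomial with the single term
        \<open>i = 0\<close>.\<close>
      using gegenbauer_integral_tendsto[OF True, where K=0 and e="\<lambda>_. 0" and c="\<lambda>_ _. 1" and ?c0.0="\<lambda>_. 1"]
      by (simp add: L0_def[abs_def] J0_def)
    have L1: "(L1 \<longlongrightarrow> J1) at_top"
      using gegenbauer_integral_tendsto[OF a(2) c, where K="\<nu> div 2" and e=e]
      by (simp add: L1_def[abs_def] J1_def herm g_def)
    have J0: "J0 > 0"
      using hermite_integral_pos[OF True inj_on_id, of 0 0 "\<lambda>_. 1"] by (simp add: J0_def)
    have J1: "J1 > 0"
      using hermite_integral_pos[OF a(2) e order_refl[of "\<nu> div 2"], of c0] c0 by (simp add: J1_def herm)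
    have g_lim: "((\<lambda>\<gamma>. g \<gamma> t) \<longlongrightarrow> gen_hermite \<nu> a t) at_top"
      unfolding g_def herm by (intro tendsto_intros c)
    have "((\<lambda>\<gamma>. g \<gamma> t * homogenize m p x t / sqrt (L1 \<gamma> / L0 \<gamma>)) \<longlongrightarrow>
        gen_hermite \<nu> a t * homogenize m p x t / sqrt (J1 / J0)) at_top"
      using J0 J1 by (intro tendsto_intros g_lim L0 L1) auto
    moreover have "\<forall>\<^sub>F \<gamma> in at_top. g \<gamma> t * homogenize m p x t / sqrt (L1 \<gamma> / L0 \<gamma>) =
        cone_gegenbauer \<beta> \<gamma> \<mu> m n p (x /\<^sub>R sqrt \<gamma>) (t / sqrt \<gamma>)
          / sqrt (norm2_cone_gegenbauer \<beta> \<gamma> \<mu> m n p)"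
      using N eventually_gt_at_top[of 0]
    proof eventually_elim
      case (elim \<gamma>)
      define \<rho> where "\<rho> = sqrt \<gamma>"
      have \<rho>: "\<rho> > 0" using elim by (simp add: \<rho>_def)
      have geg: "gen_gegenbauer \<nu> \<gamma> a (s / \<rho>) = N \<gamma> * g \<gamma> s" for s
        using elim by (simp add: g_def \<rho>_def)
      have pw: "\<bar>s / \<rho>\<bar> powr q = \<rho> powr (- q) * \<bar>s\<bar> powr q" for s q
        using \<rho> by (simp add: abs_divide powr_divide powr_minus field_simps)
      have rescale: "(LINT s|lborel. f s) = (LINT s|lborel. f (s / \<rho>)) / \<rho>" for f :: "real \<Rightarrow> real"
        using lborel_integral_real_affine[of "1 / \<rho>" f 0] \<rho> by simp
      have K0': "K0 \<gamma> = \<rho> powr (- (2 * a - 2 * real m)) * L0 \<gamma> / \<rho>"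
      proof -
        have "K0 \<gamma> = (LINT s|lborel. \<rho> powr (- (2 * a - 2 * real m)) *
            (gegenbauer_weight \<gamma> (s / \<rho>) * \<bar>s\<bar> powr (2 * a - 2 * real m))) / \<rho>"
          unfolding K0_def by (subst rescale) (simp only: pw mult_ac)
        then show ?thesis by (simp add: L0_def \<rho>_def)
      qed
      have K1': "K1 \<gamma> = \<rho> powr (- (2 * a)) * (N \<gamma>)\<^sup>2 * L1 \<gamma> / \<rho>"
      proof -
        have "K1 \<gamma> = (LINT s|lborel. \<rho> powr (- (2 * a)) * (N \<gamma>)\<^sup>2 *
            ((g \<gamma> s)\<^sup>2 * gegenbauer_weight \<gamma> (s / \<rho>) * \<bar>s\<bar> powr (2 * a))) / \<rho>"
          unfolding K1_def by (subst rescale) (simp only: pw geg power_mult_distrib mult_ac)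
        then show ?thesis by (simp add: L1_def \<rho>_def)
      qed
      \<comment> \<open>The two weights differ by \<open>2 m\<close> in the exponent. After the
        square root this leaves \<open>\<rho> ^ m\<close>, the factor by which rescaling divides the
        homogenized polynomial.\<close>
      have "\<rho> powr (- (2 * a - 2 * real m)) = \<rho> powr (- (2 * a)) * (\<rho> ^ m)\<^sup>2"
      proof -
        have "\<rho> powr (- (2 * a - 2 * real m)) = \<rho> powr (- (2 * a)) * \<rho> powr real (m * 2)"
          by (simp flip: powr_add add: algebra_simps)
        also have "\<rho> powr real (m * 2) = (\<rho> ^ m)\<^sup>2"
          using \<rho> by (simp only: powr_realpow power_mult)
        finally show ?thesis .
      qed
      then have "K1 \<gamma> / K0 \<gamma> = (N \<gamma> / \<rho> ^ m)\<^sup>2 * (L1 \<gamma> / L0 \<gamma>)"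
        unfolding K0' K1' using \<rho> by (simp add: power_divide)
      \<comment> \<open>Positivity of \<open>N \<gamma>\<close> and \<open>\<rho>\<close> removes
        the absolute value; the factor \<open>N \<gamma> / \<rho> ^ m\<close> then cancels against
        the same factor of \<open>cone_gegenbauer\<close>.\<close>
      then have "sqrt (K1 \<gamma> / K0 \<gamma>) = N \<gamma> / \<rho> ^ m * sqrt (L1 \<gamma> / L0 \<gamma>)"
        using elim \<rho> by (simp only: real_sqrt_mult real_sqrt_abs) simp
      moreover have "homogenize m p (x /\<^sub>R \<rho>) (t / \<rho>) = homogenize m p x t / \<rho> ^ m"
        using homogenize_scale[OF deg, of "inverse \<rho>" x t]
        by (simp add: divide_inverse power_inverse mult.commute)
      ultimately show ?case
        unfolding cone_gegenbauer_def hC a_def[symmetric] \<nu>_def[symmetric] \<rho>_def[symmetric] geg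
        using elim \<rho> by simp
    qed
    ultimately show ?thesis
      unfolding p_def[symmetric] hH unfolding cone_hermite_def a_def[symmetric] \<nu>_def[symmetric]
      by (rule Lim_transform_eventually)
  qed
qed

end
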